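(* For every integer $h\ge2$ there is a sequence of finite sets $F_1,F_2,\dots\subset\mathbb Z_{>0}$ such that each $F_i$ is a $B_{h-1}$ set, $\lvert F_i\rvert\to\infty$, and $F_i\subset\{1,\dots,M_i\}$ with $M_i\le\lvert F_i\rvert^{h-1}$. Consequently, for every fixed integer $g\ge1$, $$\frac{b_{h,g}(F_i)}{\lvert F_i\rvert}=O_{h,g}\bigl(\lvert F_i\rvert^{-1/h}\bigr)\longrightarrow0 .$$ In particular, for every $h\ge2$ and $g\ge1$ there exist finite $F\subset\mathbb Z_{>0}$ that are $B_{h-1}$ sets but not $B_h[g]$ sets.
   Context: For integers $k,g\ge1$, a set $B\subset\mathbb Z$ is a $B_k[g]$ set if every integer has at most $g$ representations as a sum of a size-$k$ multiset of elements of $B$ (sum counted with multiplicity); a $B_k$ set is a $B_k[1]$ set. In particular every set is a $B_1$ set. $b_{h,g}(F)$ denotes the largest size of a $B_h[g]$ subset of $F$. *)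

theory Defs
  imports "HOL-Library.Multiset" "HOL-Library.Landau_Symbols"
begin

definition sum_reps :: "nat \<Rightarrow> int set \<Rightarrow> int \<Rightarrow> int multiset set" where
  "sum_reps k B n = {S. size S = k \<and> set_mset S \<subseteq> B \<and> sum_mset S = n}"

(* Finiteness is required explicitly because card is 0 on infinite sets, and B may be infinite. *)
definition B_set :: "nat \<Rightarrow> nat \<Rightarrow> int set \<Rightarrow> bool" where
  "B_set k g B \<longleftrightarrow> (\<forall>n. finite (sum_reps k B n) \<and> card (sum_reps k B n) \<le> g)"

(* Meaningful for finite F only: then the maximum ranges over a finite set,
   which is nonempty because the empty set is a B_h[g] set for h >= 1. *)
definition max_B_card :: "nat \<Rightarrow> nat \<Rightarrow> int set \<Rightarrow> nat" where
  "max_B_card h g F = Max (card ` {A. A \<subseteq> F \<and> B_set h g A})"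

end

(* Let k = h - 1. For k >= 2 we use the Bose-Chowla construction: fix theta generating the
   multiplicative group of the field with q^k elements; the q exponents i in {1..q^k-1} for which
   theta^i - theta lies in the field with q elements form a B_k set, since two k-fold products of
   linear factors X + a that agree at theta differ by a polynomial of degree < k over the small
   field vanishing at theta and hence at its k distinct conjugates. Taking q = 2^m, all these fields
   sit inside a single type, the algebraic closure of GF(2). For k = 1 an interval works.

   A B_h[g] subset A of {1..M} satisfies |A|^h <= h! g h M, because every sum in {1..hM} arises from
   at most h! g ordered h-tuples; with M <= |F|^(h-1) this gives the bound on b_{h,g}(F)/|F|. *)
theory Submission
  imports
    Defs
    "HOL-Algebra.Algebraic_Closure_Type"
    "HOL-Algebra.Multiplicative_Group"
    "HOL-Combinatorics.Multiset_Permutations"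
begin

section \<open>Finite subfields as Frobenius fixed points\<close>

text \<open>With p = \<open>CHAR('a)\<close>, this is the subfield with p^n elements of an
  algebraically closed field. Encoding it as a set keeps subfields of all sizes inside one
  type.\<close>

definition frob_fixed :: "nat \<Rightarrow> 'a :: field set" where
  "frob_fixed n = {x. x ^ (CHAR('a) ^ n) = x}"

text \<open>The fixed points are the roots of X^Q - X. This polynomial splits, and its derivative is
  the constant -1, so no root is repeated and there are exactly Q of them.\<close>

lemma card_frob_fixed:
  assumes "CHAR('a :: alg_closed_field) > 0" "n > 0"
  shows "card (frob_fixed n :: 'a set) = CHAR('a) ^ n"
proof -
  define Q where "Q = CHAR('a) ^ n"
  have "prime CHAR('a)"
    using assms prime_CHAR_semidom by blast
  then have Q: "Q > 1" "of_nat Q = (0 :: 'a)"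
    using assms unfolding Q_def by (auto simp: prime_gt_1_nat power_0_left intro!: one_less_power simp del: One_nat_def)
  define P :: "'a poly" where "P = monom 1 Q - [:0, 1:]"
  have deg: "degree P = Q"
    using Q unfolding P_def diff_conv_add_uminus
    by (subst degree_add_eq_left) (auto simp: degree_monom_eq)
  have "P \<noteq> 0"
    using deg Q by auto
  have der: "pderiv P = -1"
    using Q unfolding P_def by (simp add: pderiv_diff pderiv_monom pderiv_pCons one_pCons)
  have "lead_coeff P = 1"
    using Q unfolding deg by (auto simp: P_def coeff_pCons split: nat.splits)
  then obtain A where A: "size A = Q" "P = (\<Prod>x\<in>#A. [:-x, 1:])"
    using alg_closed_imp_factorization[OF \<open>P \<noteq> 0\<close>] deg by auto
  have "count A x \<le> 1" for x
  proof (rule ccontr)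
    assume "\<not> count A x \<le> 1"
    then have "{#x, x#} \<subseteq># A"
      by (auto simp: subseteq_mset_def)
    then obtain B where "A = {#x, x#} + B"
      using mset_subset_eq_exists_conv by blast
    then have "P = [:-x, 1:] * ([:-x, 1:] * (\<Prod>x\<in>#B. [:-x, 1:]))"
      unfolding A(2) by (simp del: mult_pCons_left)
    then have "poly (pderiv P) x = 0"
      by (simp add: pderiv_mult del: mult_pCons_left)
    then show False
      by (simp add: der)
  qed
  then have "A = mset_set (set_mset A)"
    by (intro multiset_eqI) (metis antisym count_mset_set(1,3) finite_set_mset
        less_one linorder_not_le not_in_iff order_refl count_greater_eq_one_iff)
  then have "card (set_mset A) = Q"
    using A(1) by (metis size_mset_set)
  moreover have "set_mset A = frob_fixed n"
  proof -
    have "x \<in># A \<longleftrightarrow> poly P x = 0" for x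
      by (auto simp: A(2) poly_prod_mset prod_mset_zero_iff image_iff)
    then show ?thesis
      by (auto simp: P_def poly_monom frob_fixed_def Q_def)
  qed
  ultimately show ?thesis
    by (simp add: Q_def)
qed

lemma power_CHAR_diff:
  assumes "CHAR('a :: field) > 0" "m = CHAR('a) ^ n"
  shows "(x - y :: 'a) ^ m = x ^ m - y ^ m"
proof -
  have "prime CHAR('a)"
    using assms(1) prime_CHAR_semidom by blast
  \<comment> \<open>Raising (x - y) + y to the power \<open>m\<close> avoids the sign of (-1)^m,
    which depends on the parity of the characteristic.\<close>
  then have "(x - y + y) ^ m = (x - y) ^ m + y ^ m"
    using assms(2) by (rule freshmans_dream')
  then show ?thesis
    by simp
qed

lemma frob_fixed_diff:
  assumes "CHAR('a :: field) > 0" "x \<in> frob_fixed n" "y \<in> frob_fixed n"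
  shows "x - y \<in> (frob_fixed n :: 'a set)"
  using assms power_CHAR_diff[of "CHAR('a) ^ n" n x y] by (simp add: frob_fixed_def)

lemma frob_fixed_zero [simp]: "CHAR('a) > 0 \<Longrightarrow> 0 \<in> (frob_fixed n :: 'a :: field set)"
  by (simp add: frob_fixed_def)

lemma frob_fixed_add:
  assumes "CHAR('a :: field) > 0" "x \<in> frob_fixed n" "y \<in> frob_fixed n"
  shows "x + y \<in> (frob_fixed n :: 'a set)"
  using frob_fixed_diff[OF assms(1,2), of "0 - y"] frob_fixed_diff[OF assms(1) _ assms(3), of 0] assms(1)
  by simp

lemma frob_fixed_mult_subset: "frob_fixed m \<subseteq> frob_fixed (m * k)"
proof
  fix x :: 'a assume x: "x \<in> frob_fixed m"
  have "x ^ (CHAR('a) ^ (m * k)) = x"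
    using x by (induction k) (simp_all add: frob_fixed_def power_add power_mult)
  then show "x \<in> frob_fixed (m * k)"
    by (simp add: frob_fixed_def)
qed

text \<open>The multiplicative group of a finite field is cyclic. The fixed points are packaged as a
  record \<open>R\<close> to apply this fact, and powers in \<open>R\<close> are then identified
  with ordinary powers.\<close>

lemma frob_fixed_generator:
  assumes "CHAR('a :: field) > 0" "finite (frob_fixed n :: 'a set)"
  shows "\<exists>g::'a. g \<noteq> 0 \<and> frob_fixed n - {0} = range (\<lambda>i::nat. g ^ i)"
proof -
  define S :: "'a set" where "S = frob_fixed n"
  have add: "x + y \<in> S" and diff: "x - y \<in> S" if "x \<in> S" "y \<in> S" for x y
    using that assms(1) by (simp_all add: S_def frob_fixed_add frob_fixed_diff)
  have zero: "0 \<in> S" and one: "1 \<in> S"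
    using assms(1) by (simp_all add: S_def) (simp add: frob_fixed_def)
  have mult: "x * y \<in> S" if "x \<in> S" "y \<in> S" for x y
    using that by (simp add: S_def frob_fixed_def power_mult_distrib)
  have inv: "inverse x \<in> S" if "x \<in> S" for x
    using that by (simp add: S_def frob_fixed_def power_inverse)
  define R :: "'a ring" where "R = \<lparr>carrier = S, monoid.mult = (*), one = 1, ring.zero = 0, add = (+)\<rparr>"
  have neg: "\<exists>y\<in>S. x + y = 0" if "x \<in> S" for x
    using diff[OF zero that] by (intro bexI[of _ "0 - x"]) auto
  have rec: "\<exists>y\<in>S. x * y = 1" if "x \<in> S" "x \<noteq> 0" for x
    using inv[OF that(1)] that by (intro bexI[of _ "inverse x"]) auto
  have "field R"
    unfolding R_def
    by unfold_locales (auto simp: add zero one mult algebra_simps Units_def intro: neg rec)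
  interpret R: field R by fact
  obtain g where g: "g \<in> carrier (mult_of R)" "carrier (mult_of R) = {g [^]\<^bsub>R\<^esub> i | i::nat. i \<in> UNIV}"
    using R.finite_field_mult_group_has_gen assms(2) by (auto simp: R_def S_def)
  have "x [^]\<^bsub>R\<^esub> i = x ^ i" for x and i :: nat
    by (induction i) (auto simp: R_def nat_pow_def mult.commute)
  then show ?thesis
    using g by (auto simp: R_def S_def)
qed

lemma B_set_1I:
  assumes "\<And>S T. size S = k \<Longrightarrow> size T = k \<Longrightarrow> set_mset S \<subseteq> B \<Longrightarrow> set_mset T \<subseteq> B
    \<Longrightarrow> sum_mset S = sum_mset T \<Longrightarrow> S = T"
  shows "B_set k 1 B"
  unfolding B_set_def
proof
  fix n
  have eq: "S = T" if "S \<in> sum_reps k B n" "T \<in> sum_reps k B n" for S T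
    using assms that by (auto simp: sum_reps_def)
  then have fin: "finite (sum_reps k B n)"
    by (metis finite.emptyI finite.insertI finite_subset insertI1 subsetI)
  with eq show "finite (sum_reps k B n) \<and> card (sum_reps k B n) \<le> 1"
    by (auto simp: card_le_Suc0_iff_eq)
qed

text \<open>The two claims share one induction: splitting \<open>nat\<close> of a sum in the first
  needs the nonnegativity in the second.\<close>

lemma prod_mset_power_nat:
  fixes x :: "'a :: comm_semiring_1"
  assumes "\<forall>i\<in>#S. i \<ge> 0"
  shows "(\<Prod>i\<in>#S. x ^ nat i) = x ^ nat (sum_mset S)" "sum_mset S \<ge> 0"
  using assms by (induction S) (auto simp: nat_add_distrib power_add)

text \<open>Degree and leading coefficient make the difference of two such products of equal size
  drop in degree; the roots recover the multiset of values of \<open>f\<close>.\<close>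

lemma prod_mset_linear_factors:
  fixes f :: "'b \<Rightarrow> 'a :: field"
  shows "degree (\<Prod>i\<in>#S. [:f i, 1:]) = size S" (is ?deg)
    and "lead_coeff (\<Prod>i\<in>#S. [:f i, 1:]) = 1" (is ?lead)
    and "proots (\<Prod>i\<in>#S. [:f i, 1:]) = image_mset (\<lambda>i. - f i) S" (is ?proots)
proof -
  have lead: "lead_coeff (\<Prod>i\<in>#S. [:f i, 1:]) = 1" for S
    by (induction S) (simp_all add: lead_coeff_mult del: mult_pCons_left)
  then have nz: "(\<Prod>i\<in>#S. [:f i, 1:]) \<noteq> 0" for S :: "'b multiset"
    by (metis leading_coeff_0_iff zero_neq_one)
  show ?deg
    by (induction S) (use nz in \<open>simp_all add: degree_mult_eq del: mult_pCons_left\<close>)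
  show ?proots
    by (induction S) (use nz in \<open>simp_all add: proots_mult del: mult_pCons_left\<close>)
  show ?lead by (rule lead)
qed

section \<open>The Bose-Chowla construction\<close>

lemma Bose_Chowla:
  assumes char: "CHAR('a :: alg_closed_field) > 0" and "m > 0" "k \<ge> 2"
  defines "q \<equiv> CHAR('a) ^ m"
  shows "\<exists>F. F \<subseteq> {1..int q ^ k - 1} \<and> card F = q \<and> B_set k 1 F"
proof -
  have "prime CHAR('a)"
    using char prime_CHAR_semidom by blast
  then have q: "q > 1"
    using \<open>m > 0\<close> unfolding q_def by (metis one_less_power prime_gt_1_nat)
  \<comment> \<open>\<open>E\<close> is the small field with q elements, \<open>K\<close> its
    extension of degree k, and \<open>N\<close> below the order of the multiplicative group of
    \<open>K\<close>.\<close>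
  define E K :: "'a set" where "E = frob_fixed m" and "K = frob_fixed (m * k)"
  define N where "N = q ^ k - 1"
  have "q ^ 1 < q ^ k"
    using q \<open>k \<ge> 2\<close> by (intro power_strict_increasing) auto
  then have N: "N > 0" "Suc N = q ^ k"
    using q by (simp_all add: N_def)
  have card_E: "card E = q" and card_K: "card K = q ^ k"
    using card_frob_fixed[where 'a = 'a] char \<open>m > 0\<close> \<open>k \<ge> 2\<close>
    by (simp_all add: E_def K_def q_def power_mult)
  have K_eq: "K = {x. x ^ q ^ k = x}" and E_eq: "E = {x. x ^ q = x}"
    by (simp_all add: K_def E_def frob_fixed_def q_def power_mult)
  have "E \<subseteq> K"
    by (simp add: E_def K_def frob_fixed_mult_subset)
  have fin: "finite K"
    using card_K q by (metis card.infinite not_one_less_zero power_eq_0_iff)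
  obtain \<theta> where \<theta>: "\<theta> \<noteq> 0" "K - {0} = range (\<lambda>i::nat. \<theta> ^ i)"
    using frob_fixed_generator[OF char] fin unfolding K_def by blast
  have "\<theta> \<in> K"
    using \<theta>(2) by (metis DiffD1 power_one_right rangeI)
  then have "\<theta> * \<theta> ^ N = \<theta> * 1"
    by (simp add: K_eq flip: N(2))
  then have ord: "\<theta> ^ N = 1"
    using \<theta>(1) by simp
  \<comment> \<open>Exponents are reduced modulo \<open>N\<close> to 1..N rather than 0..N-1, with
    \<open>N\<close> standing for remainder 0, so that the exponents collected in \<open>F\<close>
    are positive.\<close>
  have range_eq: "K - {0} = (\<lambda>i. \<theta> ^ i) ` {1..N}"
  proof -
    have "\<theta> ^ i \<in> (\<lambda>i. \<theta> ^ i) ` {1..N}" for i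
    proof -
      have "\<theta> ^ i = (\<theta> ^ N) ^ (i div N) * \<theta> ^ (i mod N)"
        by (simp flip: power_mult power_add)
      then have *: "\<theta> ^ i = \<theta> ^ (i mod N)"
        by (simp add: ord)
      show ?thesis
      proof (cases "i mod N = 0")
        case True
        then show ?thesis
          using * ord N by (intro image_eqI[of _ _ N]) auto
      next
        case False
        then show ?thesis
          using * N by (intro image_eqI[of _ _ "i mod N"]) (auto simp: less_imp_le)
      qed
    qed
    then show ?thesis
      using \<theta>(2) by auto
  qed
  \<comment> \<open>The \<open>N\<close> exponents hit all \<open>N\<close> nonzero elements of
    \<open>K\<close>, so the powers are pairwise distinct.\<close>
  have "card ((\<lambda>i. \<theta> ^ i) ` {1..N}) = card {1..N}"
    using card_K fin char unfolding range_eq[symmetric] by (simp add: K_def N_def)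
  then have inj: "inj_on (\<lambda>i. \<theta> ^ i) {1..N}"
    by (intro eq_card_imp_inj_on) auto
  have conj_inj: "inj_on (\<lambda>j. \<theta> ^ q ^ j) {..<k}"
  proof
    fix i j assume ij: "i \<in> {..<k}" "j \<in> {..<k}" "\<theta> ^ q ^ i = \<theta> ^ q ^ j"
    have "q ^ i < q ^ k" "q ^ j < q ^ k"
      using ij q by (auto intro: power_strict_increasing)
    then have "q ^ i \<in> {1..N}" "q ^ j \<in> {1..N}"
      using q unfolding N(2)[symmetric] by auto
    then have "q ^ i = q ^ j"
      using inj ij by (metis inj_onD)
    then show "i = j"
      using q by (simp add: power_inject_exp)
  qed
  \<comment> \<open>Membership in \<open>E\<close> would make the conjugates with j = 0 and j = 1
    coincide, which k >= 2 forbids.\<close>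
  have "\<theta> \<notin> E"
    using inj_onD[OF conj_inj, of 0 1] \<open>k \<ge> 2\<close> by (auto simp: E_eq)
  \<comment> \<open>Commuting with the q-th power replaces the condition that the coefficients lie
    in \<open>E\<close>. It carries the root theta to all k conjugates, more roots than the degree
    permits.\<close>
  have P_zero: "P = 0" if P: "poly P \<theta> = 0" "\<And>x. poly P x ^ q = poly P (x ^ q)" "degree P < k" for P
  proof (rule ccontr)
    assume "P \<noteq> 0"
    have "poly P (\<theta> ^ q ^ j) = 0" for j
    proof (induction j)
      case (Suc j)
      have "poly P (\<theta> ^ q ^ Suc j) = poly P (\<theta> ^ q ^ j) ^ q"
        by (simp add: P(2) mult.commute flip: power_mult)
      then show ?case
        using Suc q by simp
    qed (simp add: P)
    then have "(\<lambda>j. \<theta> ^ q ^ j) ` {..<k} \<subseteq> {x. poly P x = 0}"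
      by auto
    then have "card ((\<lambda>j. \<theta> ^ q ^ j) ` {..<k}) \<le> card {x. poly P x = 0}"
      using \<open>P \<noteq> 0\<close> by (intro card_mono poly_roots_finite)
    then show False
      using card_poly_roots_bound[OF \<open>P \<noteq> 0\<close>] \<open>degree P < k\<close> conj_inj by (simp add: card_image)
  qed
  \<comment> \<open>For i in \<open>F\<close>, \<open>f i\<close> is the element a of
    \<open>E\<close> with theta^i = theta + a, so \<open>F\<close> consists of the discrete
    logarithms of the translates of theta by \<open>E\<close>.\<close>
  define f :: "int \<Rightarrow> 'a" where "f i = \<theta> ^ nat i - \<theta>" for i
  define F where "F = {i \<in> {1..int N}. f i \<in> E}"
  have inj_f: "inj_on f F"
  proof
    fix i j assume "i \<in> F" "j \<in> F" "f i = f j"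
    then have "nat i \<in> {1..N}" "nat j \<in> {1..N}" "\<theta> ^ nat i = \<theta> ^ nat j" "i > 0" "j > 0"
      by (auto simp: F_def f_def)
    then show "i = j"
      using inj by (metis inj_onD eq_nat_nat_iff less_imp_le)
  qed
  have "f ` F = E"
  proof
    show "E \<subseteq> f ` F"
    proof
      fix a assume a: "a \<in> E"
      then have "\<theta> + a \<in> K"
        using \<open>\<theta> \<in> K\<close> \<open>E \<subseteq> K\<close> frob_fixed_add[OF char] by (auto simp: K_def)
      \<comment> \<open>Only nonzero elements are powers of theta; a zero here would put theta = -a
        into \<open>E\<close>.\<close>
      moreover have "\<theta> + a \<noteq> 0"
      proof
        assume "\<theta> + a = 0"
        then have "\<theta> = 0 - a"
          by (simp add: eq_neg_iff_add_eq_0)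
        then show False
          using \<open>\<theta> \<notin> E\<close> a frob_fixed_diff[OF char, of 0 m a] char by (simp add: E_def)
      qed
      ultimately obtain i where i: "i \<in> {1..N}" "\<theta> + a = \<theta> ^ i"
        using range_eq by blast
      then have "f (int i) = a"
        by (simp add: f_def flip: i(2))
      then show "a \<in> f ` F"
        using i a by (intro image_eqI[of _ _ "int i"]) (auto simp: F_def)
    qed
  qed (auto simp: F_def)
  then have "card F = q"
    using card_image[OF inj_f] card_E by simp
  moreover have "F \<subseteq> {1..int q ^ k - 1}"
    using q by (auto simp: F_def N_def of_nat_diff)
  moreover have "B_set k 1 F"
  proof (rule B_set_1I)
    fix S T assume ST: "size S = k" "size T = k" "set_mset S \<subseteq> F" "set_mset T \<subseteq> F"
      "sum_mset S = sum_mset T"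
    define P where "P S = (\<Prod>i\<in>#S. [:f i, 1:])" for S
    have poly_P: "poly (P S) x = (\<Prod>i\<in>#S. f i + x)" for S x
      by (simp add: P_def poly_prod_mset image_mset.compositionality o_def)
    \<comment> \<open>At theta each factor becomes theta^i, so the value depends only on the sum of
      \<open>S\<close>, and equal sums give equal values.\<close>
    have root: "poly (P S) \<theta> = \<theta> ^ nat (sum_mset S)" if "set_mset S \<subseteq> F" for S
      using that prod_mset_power_nat(1)[of S \<theta>] by (force simp: poly_P f_def F_def)
    have frob: "poly (P S) x ^ q = poly (P S) (x ^ q)" if "set_mset S \<subseteq> F" for S x
      unfolding poly_P using that
    proof (induction S)
      case (add i S)
      have "(f i + x) ^ q = f i ^ q + x ^ q"
        using \<open>prime CHAR('a)\<close> by (intro freshmans_dream'[of _ m]) (auto simp: q_def)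
      with add show ?case
        by (simp add: power_mult_distrib F_def E_eq)
    qed simp
    have "P S - P T = 0"
    proof (rule P_zero)
      show "poly (P S - P T) \<theta> = 0"
        using ST by (simp add: root)
      show "poly (P S - P T) x ^ q = poly (P S - P T) (x ^ q)" for x
      proof -
        have "poly (P S - P T) x ^ q = poly (P S) x ^ q - poly (P T) x ^ q"
          unfolding q_def poly_diff using char by (rule power_CHAR_diff) simp
        then show ?thesis
          using ST by (simp only: frob poly_diff)
      qed
      \<comment> \<open>Both polynomials are monic of degree k, so the top terms cancel; k > 0
        covers a zero difference, whose degree is 0.\<close>
      have "degree (P S) = k" "degree (P T) = k"
        using ST by (simp_all only: P_def prod_mset_linear_factors(1))
      moreover have "lead_coeff (P S) = lead_coeff (P T)"
        by (simp only: P_def prod_mset_linear_factors(2))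
      ultimately show "degree (P S - P T) < k"
        using \<open>k \<ge> 2\<close> by (intro degree_lessI) (auto simp: coeff_eq_0 le_less)
    qed
    then have "proots (P S) = proots (P T)"
      by simp
    \<comment> \<open>Equal polynomials have equal root multisets, and injectivity of
      \<open>f\<close> on \<open>F\<close> then returns the exponents.\<close>
    then have "image_mset (\<lambda>i. - f i) S = image_mset (\<lambda>i. - f i) T"
      by (simp only: P_def prod_mset_linear_factors)
    then show "S = T"
      using ST(3,4) inj_f by (elim multiset.inj_map_strong[rotated]) (auto dest: inj_onD)
  qed
  ultimately show ?thesis
    by blast
qed

section \<open>Dense B_k sets of size 2^m\<close>

text \<open>The interval 1..2^m serves k = 1, where the two fields of the construction would
  coincide. For k >= 2 the ambient field is the algebraic closure of \<open>gf2\<close>, so q =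
  2^m.\<close>

lemma dense_B_set:
  assumes "k \<ge> 1" "m > 0"
  shows "\<exists>F. F \<subseteq> {1..int (card F) ^ k} \<and> card F = 2 ^ m \<and> B_set k 1 F"
proof (cases "k = 1")
  case True
  have "B_set 1 1 {1..2 ^ m}"
    by (rule B_set_1I) (auto dest!: size_1_singleton_mset[unfolded One_nat_def])
  then show ?thesis
    using True by (intro exI[of _ "{1..2 ^ m}"]) auto
next
  case False
  have "(1 :: gf2) + 1 = 0"
    by transfer simp
  then have "CHAR(gf2) dvd 2"
    by (simp flip: of_nat_eq_0_iff_char_dvd)
  then have char: "CHAR(gf2 alg_closure) = 2"
    by (metis CHAR_alg_closure CHAR_not_1' One_nat_def prime_nat_iff two_is_prime_nat)
  have "\<exists>F. F \<subseteq> {1..int (2 ^ m) ^ k - 1} \<and> card F = 2 ^ m \<and> B_set k 1 F"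
    using Bose_Chowla[where 'a = "gf2 alg_closure", of m k] False assms unfolding char by simp
  then obtain F where "F \<subseteq> {1..int (2 ^ m) ^ k - 1}" "card F = 2 ^ m" "B_set k 1 F"
    by blast
  moreover from this have "F \<subseteq> {1..int (card F) ^ k}"
    by auto
  ultimately show ?thesis
    by blast
qed

section \<open>Counting bound for B_h[g] sets\<close>

lemma sum_mset_bounds:
  assumes "set_mset S \<subseteq> {1..M :: int}"
  shows "int (size S) \<le> sum_mset S" "sum_mset S \<le> int (size S) * M"
  using assms by (induction S) (auto simp: algebra_simps)

lemma B_set_card_bound:
  assumes A: "A \<subseteq> {1..int M}" and B: "B_set h g A" and "h \<ge> 1"
  shows "card A ^ h \<le> h * M * (g * fact h)"
proof -
  have "finite A"
    using A finite_subset by blast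
  \<comment> \<open>\<open>L\<close> holds all ordered h-tuples from \<open>A\<close>.
    \<open>U n\<close> collects the orderings of the at most g multisets with sum n, each having at
    most h! orderings.\<close>
  define L where "L = {xs. set xs \<subseteq> A \<and> length xs = h}"
  define U where "U n = (\<Union>S\<in>sum_reps h A n. permutations_of_multiset S)" for n
  have fin: "finite (sum_reps h A n)" for n
    using B by (simp add: B_set_def)
  have "card (permutations_of_multiset S) \<le> fact h" if "S \<in> sum_reps h A n" for S n
    using that by (auto simp: sum_reps_def card_permutations_of_multiset)
  then have "card (U n) \<le> card (sum_reps h A n) * fact h" for n
    unfolding U_def using fin by (intro order_trans[OF card_UN_le] sum_bounded_above[THEN order_trans]) auto
  also have "card (sum_reps h A n) * fact h \<le> g * fact h" for n
    using B by (simp add: B_set_def)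
  finally have card_U: "card (U n) \<le> g * fact h" for n .
  have "L \<subseteq> (\<Union>n\<in>{1..int (h * M)}. U n)"
  proof
    fix xs assume xs: "xs \<in> L"
    then have "xs \<in> U (sum_list xs)"
      by (auto simp: L_def U_def sum_reps_def sum_mset_sum_list intro!: exI[of _ "mset xs"] permutations_of_multisetI)
    \<comment> \<open>The sum lies between h and hM, and h >= 1 places it in 1..hM.\<close>
    moreover have "sum_list xs \<in> {1..int (h * M)}"
    proof -
      have "set_mset (mset xs) \<subseteq> {1..int M}" "length xs = h"
        using xs A by (auto simp: L_def)
      then show ?thesis
        using sum_mset_bounds[of "mset xs" "int M"] \<open>h \<ge> 1\<close>
        by (auto simp: sum_mset_sum_list)
    qed
    ultimately show "xs \<in> (\<Union>n\<in>{1..int (h * M)}. U n)"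
      by blast
  qed
  then have "card L \<le> card (\<Union>n\<in>{1..int (h * M)}. U n)"
    using fin by (intro card_mono) (auto simp: U_def)
  also have "\<dots> \<le> (\<Sum>n\<in>{1..int (h * M)}. card (U n))"
    by (intro card_UN_le) simp
  also have "\<dots> \<le> h * M * (g * fact h)"
    using sum_bounded_above[of "{1..int (h * M)}" "\<lambda>n. card (U n)" "g * fact h"] card_U
    by (simp add: nat_mult_distrib)
  finally show ?thesis
    using card_lists_length_eq[OF \<open>finite A\<close>, of h] by (simp add: L_def)
qed

section \<open>The ratio of the largest B_h[g] subset to the whole set\<close>

lemma max_B_card_ge:
  assumes "finite F" "A \<subseteq> F" "B_set h g A"
  shows "card A \<le> max_B_card h g F"
  unfolding max_B_card_def using assms by (intro Max_ge) auto

lemma max_B_card_attained: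
  assumes "finite F" "h \<ge> 1"
  obtains A where "A \<subseteq> F" "B_set h g A" "card A = max_B_card h g F"
proof -
  \<comment> \<open>As h >= 1, no multiset of size h has empty support; hence the family under
    \<open>Max\<close> contains the empty set.\<close>
  have "sum_reps h {} n = {}" for n
    using assms(2) by (auto simp: sum_reps_def)
  then have "B_set h g {}"
    by (simp add: B_set_def)
  then have "max_B_card h g F \<in> card ` {A. A \<subseteq> F \<and> B_set h g A}"
    unfolding max_B_card_def using assms(1) by (intro Max_in) auto
  then show ?thesis
    using that by auto
qed

text \<open>With b the maximum, n the size of \<open>F\<close> and C = h g h!, the counting bound
  for M = n^(h-1) reads b^h <= C n^(h-1). Division by n^h and an h-th root finish.\<close>

lemma max_B_card_ratio_bound:
  assumes F: "F \<subseteq> {1..int (card F) ^ (h - 1)}" "card F > 0" and "h \<ge> 1"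
  shows "real (max_B_card h g F) / real (card F)
    \<le> real (h * (g * fact h)) powr (1 / real h) * real (card F) powr (- 1 / real h)"
proof -
  define n C where "n = card F" and "C = h * (g * fact h)"
  have "finite F"
    using F card_gt_0_iff by blast
  then obtain A where A: "A \<subseteq> F" "B_set h g A" "card A = max_B_card h g F"
    using max_B_card_attained \<open>h \<ge> 1\<close> by blast
  define b where "b = max_B_card h g F"
  have "A \<subseteq> {1..int (n ^ (h - 1))}"
    using A(1) F(1) by (simp add: n_def)
  then have "card A ^ h \<le> h * n ^ (h - 1) * (g * fact h)"
    using A(2) \<open>h \<ge> 1\<close> by (rule B_set_card_bound)
  then have "b ^ h \<le> C * n ^ (h - 1)"
    by (simp add: A(3) b_def C_def mult_ac)
  then have "real (b ^ h) \<le> real (C * n ^ (h - 1))"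
    by (rule of_nat_mono)
  moreover have "real n ^ h = real n * real n ^ (h - 1)"
    using \<open>h \<ge> 1\<close> by (metis One_nat_def Suc_le_lessD power_minus_mult mult.commute)
  ultimately have *: "(real b / real n) ^ h \<le> real C / real n"
    using F(2) by (simp add: power_divide divide_simps n_def)
  have "real b / real n = root h ((real b / real n) ^ h)"
    using \<open>h \<ge> 1\<close> by (simp add: real_root_power_cancel)
  also have "\<dots> \<le> root h (real C / real n)"
    using * \<open>h \<ge> 1\<close> by simp
  also have "\<dots> = (real C / real n) powr (1 / real h)"
    using \<open>h \<ge> 1\<close> by (simp add: root_powr_inverse)
  also have "\<dots> = real C powr (1 / real h) * real n powr (- 1 / real h)"
    by (simp add: powr_divide powr_minus_divide)
  finally show ?thesis
    by (simp only: b_def n_def C_def)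
qed

lemma max_B_card_ratio_bigo:
  fixes F :: "nat \<Rightarrow> int set"
  assumes "\<And>i. F i \<subseteq> {1..int (card (F i)) ^ (h - 1)}" "\<And>i. card (F i) > 0" "h \<ge> 1"
  shows "(\<lambda>i. real (max_B_card h g (F i)) / real (card (F i)))
    \<in> O[sequentially](\<lambda>i. real (card (F i)) powr (- 1 / real h))"
proof (intro bigoI always_eventually allI)
  fix i
  show "norm (real (max_B_card h g (F i)) / real (card (F i)))
      \<le> real (h * (g * fact h)) powr (1 / real h) * norm (real (card (F i)) powr (- 1 / real h))"
    using max_B_card_ratio_bound[of "F i" h g, OF assms(1,2,3)] by simp
qed

text \<open>A negative power of a size tending to infinity is o(1), and so is anything bounded by a
  constant multiple of it.\<close>

lemma max_B_card_ratio_tendsto_0: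
  fixes F :: "nat \<Rightarrow> int set"
  assumes bound: "\<And>i. F i \<subseteq> {1..int (card (F i)) ^ (h - 1)}" "\<And>i. card (F i) > 0"
    and "h \<ge> 1" and lim: "filterlim (\<lambda>i. card (F i)) at_top sequentially"
  shows "(\<lambda>i. real (max_B_card h g (F i)) / real (card (F i))) \<longlonglongrightarrow> 0"
proof -
  have "(\<lambda>i. real (card (F i)) powr (- 1 / real h)) \<longlonglongrightarrow> 0"
    using \<open>h \<ge> 1\<close>
    by (intro tendsto_neg_powr filterlim_compose[OF filterlim_real_sequentially lim]) simp
  then have "(\<lambda>i. real (card (F i)) powr (- 1 / real h)) \<in> o(\<lambda>_. 1)"
    by (intro smalloI_tendsto) simp_all
  from smalloD_tendsto[OF landau_o.big_small_trans[OF max_B_card_ratio_bigo this]]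
  show ?thesis
    using assms by simp
qed

section \<open>Assembling the sequence\<close>

lemma exists_dense_B_set_sequence:
  assumes "k \<ge> 1"
  shows "\<exists>F. (\<forall>i. F i \<subseteq> {1..int (card (F i)) ^ k} \<and> card (F i) = 2 ^ Suc i \<and> B_set k 1 (F i))"
  by (intro choice allI dense_B_set assms zero_less_Suc)

text \<open>A B_h[g] set is a candidate in its own maximum, so its ratio would be at least 1; a
  ratio tending to 0 eventually rules this out.\<close>

lemma eventually_not_B_set:
  fixes F :: "nat \<Rightarrow> int set"
  assumes "(\<lambda>i. real (max_B_card h g (F i)) / real (card (F i))) \<longlonglongrightarrow> 0" "\<And>i. card (F i) > 0"
  shows "eventually (\<lambda>i. \<not> B_set h g (F i)) sequentially"
proof (rule eventually_mono)
  show "eventually (\<lambda>i. real (max_B_card h g (F i)) / real (card (F i)) < 1) sequentially"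
    using order_tendstoD(2)[OF assms(1) zero_less_one] .
  fix i
  assume "real (max_B_card h g (F i)) / real (card (F i)) < 1"
  then have "max_B_card h g (F i) < card (F i)"
    using assms(2)[of i] by (simp only: divide_less_eq_1_pos of_nat_0_less_iff of_nat_less_iff)
  then show "\<not> B_set h g (F i)"
    using max_B_card_ge[OF card_ge_0_finite[OF assms(2)] order_refl] by (meson not_less)
qed

theorem lemma5p2:
  fixes h :: nat
  assumes "h \<ge> 2"
  shows "(\<exists>(F :: nat \<Rightarrow> int set) (M :: nat \<Rightarrow> int).
            (\<forall>i. finite (F i) \<and> F i \<subseteq> {0<..} \<and> B_set (h - 1) 1 (F i)
                 \<and> F i \<subseteq> {1..M i} \<and> M i \<le> int (card (F i)) ^ (h - 1))
          \<and> filterlim (\<lambda>i. card (F i)) at_top sequentially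
          \<and> (\<forall>g::nat. g \<ge> 1 \<longrightarrow>
               (\<lambda>i. real (max_B_card h g (F i)) / real (card (F i)))
                 \<in> O[sequentially](\<lambda>i. real (card (F i)) powr (- 1 / real h))
             \<and> (\<lambda>i. real (max_B_card h g (F i)) / real (card (F i))) \<longlonglongrightarrow> 0))
       \<and> (\<forall>g::nat. g \<ge> 1 \<longrightarrow>
            (\<exists>F :: int set. finite F \<and> F \<subseteq> {0<..} \<and> B_set (h - 1) 1 F \<and> \<not> B_set h g F))"
proof -
  have h: "h \<ge> 1" and "h - 1 \<ge> 1"
    using assms by simp_all
  then obtain F where F: "\<forall>i. F i \<subseteq> {1..int (card (F i)) ^ (h - 1)} \<and>
      card (F i) = 2 ^ Suc i \<and> B_set (h - 1) 1 (F i)"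
    using exists_dense_B_set_sequence by meson
  have bound: "F i \<subseteq> {1..int (card (F i)) ^ (h - 1)}" and card: "card (F i) = 2 ^ Suc i"
    and B: "B_set (h - 1) 1 (F i)" for i
    using F by blast+
  have gt: "card (F i) > 0" for i
    unfolding card by simp
  have fin: "finite (F i)" for i
    using bound finite_atLeastAtMost_int by (rule finite_subset)
  have "{1..n} \<subseteq> {0<..}" for n :: int
    by auto
  with bound have pos: "F i \<subseteq> {0<..}" for i
    by (rule order_trans)
  have lim: "filterlim (\<lambda>i. card (F i)) at_top sequentially"
    unfolding card by (intro filterlim_subseq strict_monoI power_strict_increasing) simp_all
  note bigo = max_B_card_ratio_bigo[OF bound gt h]
  note ratio = max_B_card_ratio_tendsto_0[OF bound gt h lim]
  have ex: "\<exists>F. finite F \<and> F \<subseteq> {0<..} \<and> B_set (h - 1) 1 F \<and> \<not> B_set h g F" for g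
  proof -
    obtain i where "\<not> B_set h g (F i)"
      using eventually_happens'[OF sequentially_bot eventually_not_B_set[OF ratio gt]] by blast
    then show ?thesis
      by (intro exI[of _ "F i"] conjI fin pos B)
  qed
  \<comment> \<open>\<open>M i\<close> is taken equal to the permitted bound, so its inequality
    holds by reflexivity.\<close>
  show ?thesis
    by (rule conjI, intro exI[of _ F] exI[of _ "\<lambda>i. int (card (F i)) ^ (h - 1)"] conjI allI impI
        fin pos bound B order_refl lim bigo ratio) (intro allI impI ex)
qed

end
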